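(* Let $n\ge 2$. There exist $R>0$, $\beta>0$, a function $f:\mathbb{R}\to\mathbb{R}$, and a positive superharmonic function $\varphi\in C^2(\overline{B})$, where $B\subset\mathbb{R}^n$ is the open ball of radius $R$ centered at the origin, such that $\varphi$ is a solution to $$\begin{cases} -\Delta \varphi=f(\varphi) & \text{in } B,\\ \dfrac{\partial \varphi}{\partial\nu}+\beta \varphi=0 & \text{on }\partial B,\end{cases}$$ and $\varphi$ is not radially symmetric.
   Context: $\nu$ is the unit outer normal to $\partial B$. A function $\varphi$ of class $C^2$ is superharmonic in $B$ if $-\Delta\varphi\ge 0$ in $B$. A function on $B$ is radially symmetric if its value at $x$ depends only on the Euclidean norm $|x|$. *)

theory Defs
  imports "HOL-Analysis.Analysis"
begin

definition partial_differentiable_on ::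
    "'n::finite \<Rightarrow> (real^'n \<Rightarrow> real) \<Rightarrow> (real^'n) set \<Rightarrow> bool" where
  "partial_differentiable_on i u \<Omega> \<longleftrightarrow>
     (\<forall>x\<in>\<Omega>. (\<lambda>t::real. u (x + t *\<^sub>R axis i 1)) differentiable (at 0))"

definition partial_deriv :: "'n::finite \<Rightarrow> (real^'n \<Rightarrow> real) \<Rightarrow> real^'n \<Rightarrow> real" where
  "partial_deriv i u x = deriv (\<lambda>t::real. u (x + t *\<^sub>R axis i 1)) 0"

definition laplacian :: "(real^'n::finite \<Rightarrow> real) \<Rightarrow> real^'n \<Rightarrow> real" where
  "laplacian u x = (\<Sum>i\<in>UNIV. partial_deriv i (partial_deriv i u) x)"

definition extends_continuously_to_closure ::
    "(real^'n::finite) set \<Rightarrow> (real^'n \<Rightarrow> real) \<Rightarrow> bool" where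
  "extends_continuously_to_closure \<Omega> v \<longleftrightarrow>
     (\<exists>w. continuous_on (closure \<Omega>) w \<and> (\<forall>x\<in>\<Omega>. w x = v x))"

text \<open>
  The space \<open>C\<^sup>2\<close> of the closure of an open set \<open>\<Omega>\<close>: all partial derivatives of order at most 2
  exist in \<open>\<Omega>\<close> and extend continuously to the closure (so they are in particular continuous
  in \<open>\<Omega>\<close>); on the boundary \<open>u\<close> itself takes the values of its extension. Nothing is required
  of the values of \<open>u\<close> outside the closure.
\<close>
definition C2_closure :: "(real^'n::finite) set \<Rightarrow> (real^'n \<Rightarrow> real) \<Rightarrow> bool" where
  "C2_closure \<Omega> u \<longleftrightarrow>
     continuous_on (closure \<Omega>) u \<and>
     (\<forall>i. partial_differentiable_on i u \<Omega> \<and>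
          extends_continuously_to_closure \<Omega> (partial_deriv i u) \<and>
          (\<forall>j. partial_differentiable_on j (partial_deriv i u) \<Omega> \<and>
               extends_continuously_to_closure \<Omega> (partial_deriv j (partial_deriv i u))))"

text \<open>Meaningful for functions of class \<open>C\<^sup>2\<close> in \<open>\<Omega>\<close> only.\<close>
definition superharmonic_on :: "(real^'n::finite) set \<Rightarrow> (real^'n \<Rightarrow> real) \<Rightarrow> bool" where
  "superharmonic_on \<Omega> u \<longleftrightarrow> (\<forall>x\<in>\<Omega>. - laplacian u x \<ge> 0)"

text \<open>The unit outer normal to the sphere of radius \<open>R\<close> about the origin, at its point \<open>x\<close>.\<close>
definition outer_normal :: "real \<Rightarrow> real^'n::finite \<Rightarrow> real^'n" where
  "outer_normal R x = x /\<^sub>R R"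

text \<open>
  For \<open>x\<close> on the boundary, the derivative in the outward direction \<open>\<nu>\<close> is taken from inside the
  domain, i.e. along \<open>x + t \<nu>\<close> for \<open>t < 0\<close>.
\<close>
definition has_normal_derivative ::
    "(real^'n::finite \<Rightarrow> real) \<Rightarrow> real \<Rightarrow> real^'n \<Rightarrow> real^'n \<Rightarrow> bool" where
  "has_normal_derivative u d \<nu> x \<longleftrightarrow>
     ((\<lambda>t::real. u (x + t *\<^sub>R \<nu>)) has_real_derivative d) (at_left 0)"

definition solves_robin_problem ::
    "real \<Rightarrow> real \<Rightarrow> (real \<Rightarrow> real) \<Rightarrow> (real^'n::finite \<Rightarrow> real) \<Rightarrow> bool" where
  "solves_robin_problem R \<beta> f u \<longleftrightarrow>
     (\<forall>x\<in>ball 0 R. - laplacian u x = f (u x)) \<and>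
     (\<forall>x\<in>sphere 0 R. \<exists>d. has_normal_derivative u d (outer_normal R x) x \<and> d + \<beta> * u x = 0)"

definition radially_symmetric_on :: "(real^'n::finite) set \<Rightarrow> (real^'n \<Rightarrow> real) \<Rightarrow> bool" where
  "radially_symmetric_on \<Omega> u \<longleftrightarrow> (\<forall>x\<in>\<Omega>. \<forall>y\<in>\<Omega>. norm x = norm y \<longrightarrow> u x = u y)"

end

theory Submission
  imports Defs
begin

text \<open>
  Look for a solution radially symmetric about a point \<open>a \<noteq> 0\<close>, say \<open>\<phi> x = h (norm (x - a)\<^sup>2)\<close>;
  the equation then holds for some \<open>f\<close> as soon as \<open>h\<close> is injective. On the sphere of radius \<open>R\<close> one
  has \<open>2 (x \<bullet> (x - a)) = \<rho> + m\<close> with \<open>\<rho> = norm (x - a)\<^sup>2\<close> and \<open>m = R\<^sup>2 - norm a\<^sup>2\<close>, so the Robin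
  condition becomes \<open>h' / h = - \<beta> R / (\<rho> + m)\<close>, which is solved by \<open>h = (\<rho> + m) powr (- \<beta> R)\<close>. This
  is superharmonic in the ball when \<open>\<beta> R\<close> is small relative to \<open>R / norm a\<close>; the choice
  \<open>norm a = 1\<close>, \<open>R = 3\<close>, \<open>\<beta> R = 1/2\<close> is enough in every dimension \<open>n \<ge> 2\<close>, and gives
  \<open>f s = (n - 3) s ^ 3 + 24 s ^ 5\<close>.
\<close>

text \<open>The function \<open>h\<close> at \<open>(norm (x - a))\<^sup>2\<close> for
  \<open>R = 3\<close>, \<open>norm a = 1\<close> and \<open>\<beta> R = 1/2\<close>, so that
  \<open>m = 9 - 1 = 8\<close>.\<close>

definition profile :: "'a::real_inner \<Rightarrow> 'a \<Rightarrow> real" where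
  "profile a x = 1 / sqrt (8 + (norm (x - a))\<^sup>2)"

lemma profile_pos: "profile a x > 0"
  by (simp add: profile_def add_pos_nonneg)

lemma profile_power2: "(profile a x)\<^sup>2 * (8 + (norm (x - a))\<^sup>2) = 1"
proof -
  have "8 + (norm (x - a))\<^sup>2 > 0"
    by (simp add: add_pos_nonneg)
  then show ?thesis
    by (simp add: profile_def power_divide)
qed

lemma continuous_on_profile: "continuous_on S (profile a)"
  unfolding profile_def
  by (intro continuous_intros) (simp add: add_nonneg_eq_0_iff)

text \<open>The set \<open>S\<close> is left free to cover both the two-sided partial derivatives
  and the one-sided normal derivative.\<close>

lemma profile_has_directional_derivative:
  "((\<lambda>t. profile a (x + t *\<^sub>R v)) has_real_derivative - ((x - a) \<bullet> v) * profile a x ^ 3) (at 0 within S)"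
proof -
  \<comment> \<open>Along a line the radicand is a quadratic polynomial in \<open>t\<close>.\<close>
  define q where "q t = 8 + (norm (x - a))\<^sup>2 + 2 * t * ((x - a) \<bullet> v) + t\<^sup>2 * (norm v)\<^sup>2" for t
  have q: "profile a (x + t *\<^sub>R v) = 1 / sqrt (q t)" for t
    unfolding profile_def q_def power2_norm_eq_inner
    by (simp add: inner_diff_left inner_diff_right inner_add_left inner_add_right inner_commute
        power2_eq_square algebra_simps)
  have q0: "q 0 > 0" "profile a x = 1 / sqrt (q 0)"
    using q[of 0] by (simp_all add: q_def add_pos_nonneg)
  have "(q has_real_derivative 2 * ((x - a) \<bullet> v)) (at 0 within S)"
    unfolding q_def by (auto intro!: derivative_eq_intros)
  then have "((\<lambda>t. 1 / sqrt (q t)) has_real_derivative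
      - ((x - a) \<bullet> v) / (sqrt (q 0) * sqrt (q 0) * sqrt (q 0))) (at 0 within S)"
    using q0(1) by (auto intro!: derivative_eq_intros simp: field_simps)
  then show ?thesis
    by (simp add: q q0(2) power3_eq_cube)
qed

lemma partial_profile:
  "((\<lambda>t. profile a (x + t *\<^sub>R axis i 1)) has_real_derivative - (x - a) $ i * profile a x ^ 3) (at 0)"
  using profile_has_directional_derivative[of a x "axis i 1" UNIV] by (simp add: inner_axis)

lemma partial_deriv_profile:
  "partial_deriv i (profile a) = (\<lambda>x. - (x - a) $ i * profile a x ^ 3)"
  unfolding partial_deriv_def by (intro ext DERIV_imp_deriv partial_profile)

text \<open>Product rule; \<open>axis j 1 $ i\<close> is the Kronecker delta.\<close>

lemma partial_partial_profile:
  "((\<lambda>t. partial_deriv i (profile a) (x + t *\<^sub>R axis j 1)) has_real_derivative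
     3 * (x - a) $ i * (x - a) $ j * profile a x ^ 5 - axis j 1 $ i * profile a x ^ 3) (at 0)"
  unfolding partial_deriv_profile
  by (rule derivative_eq_intros partial_profile refl | simp)+
    (simp add: algebra_simps eval_nat_numeral)

lemma partial_deriv_partial_deriv_profile:
  "partial_deriv j (partial_deriv i (profile a)) =
     (\<lambda>x. 3 * (x - a) $ i * (x - a) $ j * profile a x ^ 5 - axis j 1 $ i * profile a x ^ 3)"
  by (rule ext, subst partial_deriv_def) (rule DERIV_imp_deriv, rule partial_partial_profile)

lemma extends_continuously_to_closureI:
  "continuous_on (closure \<Omega>) v \<Longrightarrow> extends_continuously_to_closure \<Omega> v"
  unfolding extends_continuously_to_closure_def by blast

lemma C2_closure_profile: "C2_closure \<Omega> (profile a)"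
proof -
  have "partial_differentiable_on i (profile a) \<Omega>"
    "partial_differentiable_on j (partial_deriv i (profile a)) \<Omega>" for i j
    unfolding partial_differentiable_on_def
    using partial_profile partial_partial_profile real_differentiable_def by blast+
  \<comment> \<open>The formulas are continuous on the whole space, so each derivative is its own
    extension.\<close>
  moreover have "extends_continuously_to_closure \<Omega> (partial_deriv i (profile a))"
    "extends_continuously_to_closure \<Omega> (partial_deriv j (partial_deriv i (profile a)))" for i j
    unfolding partial_deriv_partial_deriv_profile unfolding partial_deriv_profile
    by (intro extends_continuously_to_closureI continuous_intros continuous_on_profile)+
  ultimately show ?thesis
    unfolding C2_closure_def by (blast intro: continuous_on_profile)
qed

lemma laplacian_profile:
  fixes x :: "real^'n::finite"
  shows "- laplacian (profile a) x =
    (real CARD('n) - 3) * profile a x ^ 3 + 24 * profile a x ^ 5"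
proof -
  have "laplacian (profile a) x =
      3 * (norm (x - a))\<^sup>2 * profile a x ^ 5 - real CARD('n) * profile a x ^ 3"
    unfolding laplacian_def partial_deriv_partial_deriv_profile power2_norm_eq_inner inner_vec_def
    by (simp add: sum_subtractf sum.distrib sum_distrib_left sum_distrib_right algebra_simps)
  \<comment> \<open>This eliminates \<open>norm (x - a)\<close>, leaving a function of
    \<open>profile a x\<close> alone.\<close>
  moreover have "profile a x ^ 3 = (8 + (norm (x - a))\<^sup>2) * profile a x ^ 5"
    using profile_power2[of a x] by algebra
  ultimately show ?thesis
    by (simp add: algebra_simps)
qed

text \<open>The worst case is dimension 2, where \<open>24 * (profile a x)\<^sup>2 \<ge> 1\<close>
  is needed. This says \<open>norm (x - a) \<le> 4\<close>, and 4 is exactly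
  \<open>R + norm a\<close>.\<close>

lemma superharmonic_profile:
  fixes a :: "real^'n::finite"
  assumes n: "CARD('n) \<ge> 2" and a: "norm a = 1"
  shows "superharmonic_on (ball 0 3) (profile a)"
  unfolding superharmonic_on_def
proof
  fix x :: "real^'n"
  assume "x \<in> ball 0 3"
  then have "norm (x - a) \<le> 4"
    using norm_triangle_ineq4[of x a] a by simp
  then have "(norm (x - a))\<^sup>2 \<le> 4\<^sup>2"
    by (intro power_mono) auto
  then have "(profile a x)\<^sup>2 * (8 + (norm (x - a))\<^sup>2) \<le> (profile a x)\<^sup>2 * 24"
    by (intro mult_left_mono) auto
  then have "1 \<le> 24 * (profile a x)\<^sup>2"
    by (simp add: profile_power2)
  then have "0 \<le> profile a x ^ 3 * (real CARD('n) - 3 + 24 * (profile a x)\<^sup>2)"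
    using n profile_pos[of a x] by (intro mult_nonneg_nonneg) auto
  then show "0 \<le> - laplacian (profile a) x"
    unfolding laplacian_profile by (simp add: algebra_simps eval_nat_numeral)
qed

lemma profile_robin_boundary:
  fixes a :: "real^'n::finite"
  assumes a: "norm a = 1" and x: "norm x = 3"
  shows "has_normal_derivative (profile a) (- profile a x / 6) (outer_normal 3 x) x"
proof -
  have aa: "a \<bullet> a = 1" "x \<bullet> x = 9"
    using a x by (simp_all add: dot_square_norm)
  \<comment> \<open>Both sides equal \<open>18 - 2 * (a \<bullet> x)\<close> on the sphere.\<close>
  have "8 + (norm (x - a))\<^sup>2 = 6 * ((x - a) \<bullet> outer_normal 3 x)"
    unfolding outer_normal_def power2_norm_eq_inner
    by (simp add: inner_diff_left inner_diff_right aa inner_commute[of x a])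
  then have "- ((x - a) \<bullet> outer_normal 3 x) * profile a x ^ 3 = - profile a x / 6"
    using profile_power2[of a x] by (simp add: power3_eq_cube power2_eq_square mult_ac)
  then show ?thesis
    using profile_has_directional_derivative[of a x "outer_normal 3 x" "{..<0}"]
    unfolding has_normal_derivative_def by (simp only:)
qed

text \<open>The points \<open>a\<close> and \<open>- a\<close> have equal norm but lie at distances
  0 and 2 from the center \<open>a\<close>.\<close>

lemma not_radially_symmetric_profile:
  fixes a :: "real^'n::finite"
  assumes a: "norm a = 1"
  shows "\<not> radially_symmetric_on (ball 0 3) (profile a)"
proof
  assume "radially_symmetric_on (ball 0 3) (profile a)"
  then have "profile a a = profile a (- a)"
    using a unfolding radially_symmetric_on_def by simp
  moreover have "norm (- a - a) = 2"
    using a norm_scaleR[of 2 a] norm_minus_commute[of "- a" a] by (simp add: scaleR_2)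
  ultimately show False
    by (simp add: profile_def)
qed

theorem corollary3p2:
  assumes "CARD('n::finite) \<ge> 2"
  shows "\<exists>(R::real) (\<beta>::real) (f :: real \<Rightarrow> real) (\<phi> :: real^'n \<Rightarrow> real).
           R > 0 \<and> \<beta> > 0 \<and>
           C2_closure (ball 0 R) \<phi> \<and>
           (\<forall>x\<in>closure (ball 0 R). \<phi> x > 0) \<and>
           superharmonic_on (ball 0 R) \<phi> \<and>
           solves_robin_problem R \<beta> f \<phi> \<and>
           \<not> radially_symmetric_on (ball 0 R) \<phi>"
proof -
  obtain a :: "real^'n" where a: "norm a = 1"
    by (metis norm_axis_1)
  \<comment> \<open>From \<open>\<beta> R = 1/2\<close> with \<open>R = 3\<close> comes
    \<open>\<beta> = 1/6\<close>; \<open>f\<close> is read off from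
    \<open>laplacian_profile\<close>.\<close>
  have "solves_robin_problem 3 (1/6) (\<lambda>s. (real CARD('n) - 3) * s ^ 3 + 24 * s ^ 5) (profile a)"
    unfolding solves_robin_problem_def
  proof (intro conjI ballI)
    fix x :: "real^'n"
    assume "x \<in> sphere 0 3"
    then have "has_normal_derivative (profile a) (- profile a x / 6) (outer_normal 3 x) x"
      using profile_robin_boundary[OF a] by simp
    then show "\<exists>d. has_normal_derivative (profile a) d (outer_normal 3 x) x \<and> d + 1/6 * profile a x = 0"
      by (intro exI[of _ "- profile a x / 6"]) simp
  qed (rule laplacian_profile)
  then show ?thesis
    using C2_closure_profile superharmonic_profile[OF assms a] not_radially_symmetric_profile[OF a]
    by (intro exI[of _ 3] exI[of _ "1/6"] exI[of _ "\<lambda>s. (real CARD('n) - 3) * s ^ 3 + 24 * s ^ 5"]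
        exI[of _ "profile a"]) (simp add: profile_pos)
qed

end
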